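(* For any $\vec{\alpha}\in\mathbb{R}_+^d\setminus\{\vec{0}\}$ and $\rho\in\mathbb{R}$, one has $$\tilde{T}(\mathcal{P}_{\vec{\alpha},\rho})=\mathcal{P}_{T(\vec{\alpha}),\rho},$$ where $T$ is the Brun map on vectors and $\tilde{T}$ is the run-based map on binary stepped functions.
   Context: Fix an integer $d\geq 3$; $(\vec{e}_1,\ldots,\vec{e}_d)$ is the canonical basis of $\mathbb{R}^d$, $\langle\cdot|\cdot\rangle$ the standard scalar product, $\mathbb{R}_+$ the set of non-negative reals. A stepped function is a function $\mathcal{E}:\mathbb{Z}^d\times\{1,\ldots,d\}\to\mathbb{Z}$ (set $\mathfrak{F}$), compared pointwise by $\leq$; it is binary if it takes only the values $0$ and $1$ (set $\mathfrak{B}$). The face $(\vec{x},i^* )$ is the stepped function with value $1$ at $(\vec{x},i)$ and $0$ elsewhere. The stepped plane of normal vector $\vec{\alpha}\in\mathbb{R}_+^d\setminus\{\vec{0}\}$ and intercept $\rho\in\mathbb{R}$ is the binary stepped function $\mathcal{P}_{\vec{\alpha},\rho}$ such that $\mathcal{P}_{\vec{\alpha},\rho}(\vec{x},i)=1$ if and only if $\langle\vec{x}|\vec{\alpha}\rangle<\rho\leq\langle\vec{x}+\vec{e}_i|\vec{\alpha}\rangle$. Brun map. Let $X=\mathbb{R}_+^d\setminus\{\vec{0}\}$ and $X_0=\{\lambda\vec{e}_i \mid \lambda>0,\ 1\leq i\leq d\}$. For $\vec{\alpha}\in X_0$ put $B(\vec{\alpha})=I_d$. For $\vec{\alpha}=(\alpha_1,\ldots,\alpha_d)\in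 X\setminus X_0$, let $(i,j)$, $i\neq j$, be the lexicographically smallest pair with $\alpha_i=\max_{k}\alpha_k$ and $\alpha_j=\max_{k\neq i}\alpha_k$, let $a=\lfloor\alpha_i/\alpha_j\rfloor$, and let $B(\vec{\alpha})$ be the $d\times d$ matrix with $(i,i)$-entry $a$, $(i,j)$- and $(j,i)$-entries $1$, $(j,j)$-entry $0$, $(k,k)$-entry $1$ for $k\notin\{i,j\}$, and all other entries $0$. The Brun map is $T:X\to X$, $T(\vec{\alpha})=B(\vec{\alpha})^{-1}\vec{\alpha}$. Dual maps. $F_d$ is the free group on $\{1,\ldots,d\}$ (elements in reduced form); $\vec{f}:F_d\to\mathbb{Z}^d$ sends $w$ to the vector whose $i$-th entry is the sum of the exponents of $i$ in $w$. The incidence matrix $M_\sigma$ of an endomorphism $\sigma$ of $F_d$ has $i$-th column $\vec{f}(\sigma(i))$; $\sigma$ is unimodular if $\det M_\sigma=\pm1$. The dual map $E_1^*(\sigma):\mathfrak{F}\to\mathfrak{F}$ of a unimodular $\sigma$ is $$E_1^*(\sigma)(\mathcal{E})(\vec{x},i)=\sum_{\sigma(i)=p\cdot j\cdot s}\mathcal{E}(M_\sigma\vec{x}+\vec{f}(p),j)-\sum_{\sigma(i)=p\cdot j^{-1}\cdot s}\mathcal{E}(M_\sigma\vec{x}+\vec{f}(p)-\vec{e}_j,j),$$ the sums ranging over all occurrences in $\sigma(i)$ of letters $j$ (resp. inverse letters $j^{-1}$), with $p$ the prefix before and $s$ the suffix after the occurrence. The Brun substitution $\beta_{a,i,j}$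 ($a\in\mathbb{N}$, $i\neq j$) is the automorphism of $F_d$ with $\beta_{a,i,j}(i)=i^aj$, $\beta_{a,i,j}(j)=i$, $\beta_{a,i,j}(k)=k$ for $k\notin\{i,j\}$; its inverse satisfies $\beta_{a,i,j}^{-1}(i)=j$, $\beta_{a,i,j}^{-1}(j)=j^{-a}i$, $\beta_{a,i,j}^{-1}(k)=k$. Runs. For $i\neq j$ and $\mathcal{B}\in\mathfrak{B}$, an $(\vec{e}_j,i)$-run of $\mathcal{B}$ is a non-zero binary stepped function $\mathcal{R}=\sum_{k\in I}(\vec{x}+k\vec{e}_j,i^* )$, where $\vec{x}\in\mathbb{Z}^d$ and $I$ is maximal among the intervals of $\mathbb{Z}$ such that $\mathcal{R}\leq\mathcal{B}$; its length is $\#I$ (possibly infinite). The map $\tilde{T}:\mathfrak{B}\to\mathfrak{F}$. Let $\mathcal{B}\in\mathfrak{B}$. Suppose there are $i\neq j$ in $\{1,\ldots,d\}$ such that (1) for any $k\neq i$, all $(\vec{e}_i,k)$-runs and (when $k\neq j$) all $(\vec{e}_j,k)$-runs of $\mathcal{B}$, if any, have length $1$; (2) $\mathcal{B}$ has at least one finite $(\vec{e}_j,i)$-run. Take the lexicographically smallest such pair $(i,j)$, let $a$ be the length of the shortest $(\vec{e}_j,i)$-run of $\mathcal{B}$, and set $\tilde{T}(\mathcal{B})=E_1^*(\beta_{a,i,j}^{-1})(\mathcal{B})$. If there is no such pair, set $\tilde{T}(\mathcal{B})=\mathcal{B}$. *)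

theory Defs
  imports "HOL-Analysis.Analysis" "HOL-Algebra.Group" "HOL-Library.Extended_Nat"
begin

text \<open>
  The index set \<open>{1, \<dots>, d}\<close> is rendered by a type \<open>'n\<close> of sort
  \<open>{finite, linorder}\<close> with \<open>d = CARD('n)\<close>; the linear order is the one used
  for lexicographically smallest pairs.  Functions whose domain is restricted in the text
  (to \<open>X\<close>, to binary stepped functions, to unimodular endomorphisms) are total here, with
  no special role for the values outside the intended domain.
\<close>

definition is_lex_least :: "('a::linorder \<Rightarrow> 'a \<Rightarrow> bool) \<Rightarrow> 'a \<times> 'a \<Rightarrow> bool" where
  "is_lex_least P p \<longleftrightarrow> P (fst p) (snd p) \<and>
     (\<forall>i j. P i j \<longrightarrow> fst p < i \<or> (fst p = i \<and> snd p \<le> j))"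

definition lex_least :: "('a::linorder \<Rightarrow> 'a \<Rightarrow> bool) \<Rightarrow> 'a \<times> 'a" where
  "lex_least P = (THE p. is_lex_least P p)"

lemma ex1_lex_least:
  fixes P :: "'a::{finite,linorder} \<Rightarrow> 'a \<Rightarrow> bool"
  assumes "\<exists>i j. P i j"
  shows "\<exists>!p. is_lex_least P p"
proof -
  define i where "i = Min {i. \<exists>j. P i j}"
  define j where "j = Min {j. P i j}"
  have "i \<in> {i. \<exists>j. P i j}"
    unfolding i_def using assms by (intro Min_in) auto
  then have "j \<in> {j. P i j}"
    unfolding j_def by (intro Min_in) auto
  moreover have "i \<le> i'" if "P i' j'" for i' j'
    unfolding i_def using that by (intro Min_le) auto
  moreover have "j \<le> j'" if "P i j'" for j'
    unfolding j_def using that by (intro Min_le) auto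
  ultimately have *: "is_lex_least P (i, j)"
    unfolding is_lex_least_def by (auto simp: le_less)
  moreover have "p = q" if "is_lex_least P p" "is_lex_least P q" for p q
    using that unfolding is_lex_least_def by (metis order.asym order_antisym prod.expand less_irrefl)
  ultimately show ?thesis by blast
qed


subsection \<open>Stepped functions and stepped planes\<close>

type_synonym 'n stepped = "(int ^ 'n) \<times> 'n \<Rightarrow> int"

definition binary :: "'n::finite stepped \<Rightarrow> bool" where
  "binary E \<longleftrightarrow> range E \<subseteq> {0, 1}"

definition face :: "int ^ 'n \<Rightarrow> 'n \<Rightarrow> 'n::finite stepped" where
  "face x i = (\<lambda>f. if f = (x, i) then 1 else 0)"

definition real_vec :: "int ^ 'n \<Rightarrow> real ^ 'n::finite" where
  "real_vec x = (\<chi> i. real_of_int (x $ i))"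

definition stepped_plane :: "real ^ 'n \<Rightarrow> real \<Rightarrow> 'n::finite stepped" where
  "stepped_plane \<alpha> \<rho> = (\<lambda>(x, i).
     if real_vec x \<bullet> \<alpha> < \<rho> \<and> \<rho> \<le> real_vec (x + axis i 1) \<bullet> \<alpha> then 1 else 0)"

lemma binary_stepped_plane: "binary (stepped_plane \<alpha> \<rho>)"
  by (auto simp: binary_def stepped_plane_def split: if_splits)


subsection \<open>The Brun map on vectors\<close>

definition is_brun_pair :: "real ^ 'n \<Rightarrow> 'n::finite \<Rightarrow> 'n \<Rightarrow> bool" where
  "is_brun_pair \<alpha> i j \<longleftrightarrow> i \<noteq> j \<and>
     \<alpha> $ i = Max (range (\<lambda>k. \<alpha> $ k)) \<and> \<alpha> $ j = Max ((\<lambda>k. \<alpha> $ k) ` (UNIV - {i}))"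

definition brun_elementary :: "int \<Rightarrow> 'n \<Rightarrow> 'n \<Rightarrow> real ^ 'n ^ 'n::finite" where
  "brun_elementary a i j = (\<chi> r c.
     if r = i \<and> c = i then of_int a
     else if r = i \<and> c = j \<or> r = j \<and> c = i then 1
     else if r = j \<and> c = j then 0
     else if r = c then 1
     else 0)"

definition brun_matrix ::
    "real ^ 'n::{finite,linorder} \<Rightarrow> real ^ 'n::{finite,linorder} ^ 'n::{finite,linorder}" where
  "brun_matrix \<alpha> =
     (if \<alpha> \<in> {l *\<^sub>R axis i 1 | l i. l > 0} then mat 1
      else let (i, j) = lex_least (is_brun_pair \<alpha>)
           in brun_elementary \<lfloor>\<alpha> $ i / \<alpha> $ j\<rfloor> i j)"

definition brun_map ::
    "real ^ 'n::{finite,linorder} \<Rightarrow> real ^ 'n::{finite,linorder}" where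
  "brun_map \<alpha> = matrix_inv (brun_matrix \<alpha>) *v \<alpha>"


subsection \<open>The free group\<close>

datatype 'a letter = Pos 'a | Neg 'a

type_synonym 'a word = "'a letter list"

fun letter_inv :: "'a letter \<Rightarrow> 'a letter" where
  "letter_inv (Pos i) = Neg i"
| "letter_inv (Neg i) = Pos i"

definition word_inv :: "'a word \<Rightarrow> 'a word" where
  "word_inv w = rev (map letter_inv w)"

definition reduced_word :: "'a word \<Rightarrow> bool" where
  "reduced_word = successively (\<lambda>l m. m \<noteq> letter_inv l)"

definition cancel_cons :: "'a letter \<Rightarrow> 'a word \<Rightarrow> 'a word" where
  "cancel_cons l w =
     (case w of [] \<Rightarrow> [l] | m # v \<Rightarrow> if m = letter_inv l then v else l # w)"

definition reduce :: "'a word \<Rightarrow> 'a word" where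
  "reduce w = foldr cancel_cons w []"

definition free_group :: "'a word monoid" where
  "free_group = \<lparr>carrier = {w. reduced_word w}, mult = (\<lambda>u v. reduce (u @ v)), one = []\<rparr>"

text \<open>The endomorphism of the free group with prescribed images of the generators.\<close>

fun letter_image :: "('a \<Rightarrow> 'a word) \<Rightarrow> 'a letter \<Rightarrow> 'a word" where
  "letter_image g (Pos i) = g i"
| "letter_image g (Neg i) = word_inv (g i)"

definition endo :: "('a \<Rightarrow> 'a word) \<Rightarrow> 'a word \<Rightarrow> 'a word" where
  "endo g w = reduce (concat (map (letter_image g) w))"

lemma letter_inv_letter_inv [simp]: "letter_inv (letter_inv l) = l"
  by (cases l) auto

lemma letter_inv_inject [simp]: "letter_inv l = letter_inv m \<longleftrightarrow> l = m"
  by (metis letter_inv_letter_inv)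

lemma reduced_Nil [simp]: "reduced_word []"
  and reduced_single [simp]: "reduced_word [l]"
  by (auto simp: reduced_word_def)

lemma reduced_Cons: "reduced_word (l # w) \<longleftrightarrow> reduced_word w \<and> (w = [] \<or> hd w \<noteq> letter_inv l)"
  by (auto simp: reduced_word_def successively_Cons)

lemma reduced_cancel_cons: "reduced_word w \<Longrightarrow> reduced_word (cancel_cons l w)"
  by (auto simp: cancel_cons_def reduced_Cons split: list.split)

lemma reduced_foldr: "reduced_word v \<Longrightarrow> reduced_word (foldr cancel_cons u v)"
  by (induction u) (auto intro: reduced_cancel_cons)

lemma reduced_reduce [simp]: "reduced_word (reduce w)"
  by (simp add: reduce_def reduced_foldr)

lemma reduce_reduced: "reduced_word w \<Longrightarrow> reduce w = w"
  by (induction w) (auto simp: reduce_def reduced_Cons cancel_cons_def split: list.split)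

lemma cancel_cons_inverse: "reduced_word w \<Longrightarrow> cancel_cons l (cancel_cons (letter_inv l) w) = w"
  by (auto simp: cancel_cons_def reduced_Cons split: list.split)

lemma foldr_cancel_cons:
  assumes "reduced_word v"
  shows "foldr cancel_cons (cancel_cons l w) v = cancel_cons l (foldr cancel_cons w v)"
proof (cases "\<exists>w'. w = letter_inv l # w'")
  case True
  then obtain w' where w: "w = letter_inv l # w'" by blast
  then have "cancel_cons l w = w'"
    by (simp add: cancel_cons_def)
  then show ?thesis
    using cancel_cons_inverse[OF reduced_foldr[OF assms], of l w'] by (simp add: w)
next
  case False
  then have "cancel_cons l w = l # w"
    by (cases w) (auto simp: cancel_cons_def)
  then show ?thesis by simp
qed

lemma foldr_reduce: "reduced_word v \<Longrightarrow> foldr cancel_cons (reduce u) v = foldr cancel_cons u v"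
  by (induction u) (auto simp: reduce_def foldr_cancel_cons)

lemma reduce_append: "reduce (u @ v) = foldr cancel_cons u (reduce v)"
  by (simp add: reduce_def)

lemma reduce_reduce_left: "reduce (reduce u @ v) = reduce (u @ v)"
  by (simp add: reduce_append foldr_reduce)

lemma reduce_reduce_right: "reduce (u @ reduce v) = reduce (u @ v)"
  by (simp add: reduce_append reduce_reduced)

lemma word_inv_word_inv [simp]: "word_inv (word_inv w) = w"
  by (simp add: word_inv_def rev_map comp_def)

lemma foldr_word_inv:
  "reduced_word v \<Longrightarrow> foldr cancel_cons (word_inv w) (foldr cancel_cons w v) = v"
proof (induction w arbitrary: v)
  case (Cons l w)
  have "cancel_cons (letter_inv l) (cancel_cons l u) = u" if "reduced_word u" for u
    using cancel_cons_inverse[OF that, of "letter_inv l"] by simp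
  then show ?case
    using Cons by (simp add: word_inv_def reduced_foldr)
qed (simp add: word_inv_def)

lemma reduce_word_inv_append: "reduce (word_inv w @ w @ v) = reduce v"
  using foldr_word_inv[of "reduce v" w] by (simp add: reduce_append)

lemma reduce_append_word_inv: "reduce (w @ word_inv w @ v) = reduce v"
  using reduce_word_inv_append[of "word_inv w" v] by simp

lemma group_free_group: "group free_group"
proof (rule groupI)
  fix x :: "'a word"
  assume "x \<in> carrier free_group"
  then show "\<exists>y\<in>carrier free_group. y \<otimes>\<^bsub>free_group\<^esub> x = \<one>\<^bsub>free_group\<^esub>"
    using reduce_word_inv_append[of x "[]"] reduce_reduced[OF reduced_Nil]
    by (intro bexI[of _ "reduce (word_inv x)"])
       (auto simp: free_group_def reduce_reduce_left)
qed (auto simp: free_group_def reduce_reduce_left reduce_reduce_right reduce_reduced)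

lemma endo_Cons: "endo g (l # w) = foldr cancel_cons (letter_image g l) (endo g w)"
  by (simp add: endo_def reduce_append)

lemma reduced_endo [simp]: "reduced_word (endo g w)"
  by (simp add: endo_def)

lemma endo_cancel_cons: "endo g (cancel_cons l w) = endo g (l # w)"
proof (cases "\<exists>w'. w = letter_inv l # w'")
  case True
  then obtain w' where w: "w = letter_inv l # w'" by blast
  have "letter_image g (letter_inv l) = word_inv (letter_image g l)"
    by (cases l) auto
  then have "endo g (l # w) = endo g w'"
    using foldr_word_inv[of "endo g w'" "word_inv (letter_image g l)"] by (simp add: w endo_Cons)
  then show ?thesis
    by (simp add: w cancel_cons_def)
next
  case False
  then have "cancel_cons l w = l # w"
    by (cases w) (auto simp: cancel_cons_def)
  then show ?thesis by simp
qed

lemma endo_reduce: "endo g (reduce w) = endo g w"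
  by (induction w) (auto simp: reduce_def endo_cancel_cons endo_Cons)

lemma endo_append: "endo g (u @ v) = reduce (endo g u @ endo g v)"
  by (simp add: endo_def reduce_reduce_left reduce_reduce_right)

lemma endo_hom: "endo g \<in> hom free_group free_group"
  by (auto simp: hom_def free_group_def endo_reduce endo_append)

lemma endo_generator: "reduced_word (g i) \<Longrightarrow> endo g [Pos i] = g i"
  by (simp add: endo_def reduce_reduced)

lemma endo_word_inv: "endo g (word_inv w) = reduce (word_inv (endo g w))"
proof -
  have "reduce (endo g (word_inv w) @ endo g w) = []"
    using reduce_word_inv_append[of w "[]"] endo_reduce[of g "word_inv w @ w"]
    by (simp add: endo_append[symmetric]) (simp add: endo_def reduce_def)
  then have "reduce (reduce (endo g (word_inv w) @ endo g w) @ word_inv (endo g w))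
    = reduce (word_inv (endo g w))"
    by simp
  then show ?thesis
    using reduce_append_word_inv[of "endo g w" "[]"]
    by (simp add: reduce_reduce_left) (metis append.right_neutral reduce_append reduce_reduced reduced_endo reduce_def foldr.simps(1) id_apply)
qed

lemma endo_left_inverse:
  assumes "\<And>i. endo h (g i) = [Pos i]" "reduced_word w"
  shows "endo h (endo g w) = w"
proof -
  have "endo h (letter_image g l) = [l]" for l
    using assms(1) by (cases l) (simp_all add: endo_word_inv, simp add: word_inv_def reduce_reduced)
  then have "endo h (concat (map (letter_image g) w)) = reduce w" for w
  proof (induction w)
    case (Cons l w)
    then show ?case
      using reduce_reduce_right[of "[l]" w] by (simp add: endo_append)
  qed (simp add: endo_def)
  then show ?thesis
    using assms by (simp add: endo_def[of g] endo_reduce reduce_reduced)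
qed


subsection \<open>Dual maps\<close>

text \<open>The \<open>i\<close>-th entry is the sum of the exponents of the letter \<open>i\<close>.\<close>

definition abelianization :: "'n word \<Rightarrow> int ^ 'n::finite" where
  "abelianization w = (\<chi> i. int (count_list w (Pos i)) - int (count_list w (Neg i)))"

definition incidence_matrix :: "('n word \<Rightarrow> 'n word) \<Rightarrow> int ^ 'n ^ 'n::finite" where
  "incidence_matrix \<sigma> = (\<chi> r c. abelianization (\<sigma> [Pos c]) $ r)"

definition dual_map :: "('n word \<Rightarrow> 'n word) \<Rightarrow> 'n stepped \<Rightarrow> 'n::finite stepped" where
  "dual_map \<sigma> E = (\<lambda>(x, i).
     (\<Sum>(p, j, s) \<in> {(p, j, s). \<sigma> [Pos i] = p @ [Pos j] @ s}.
        E (incidence_matrix \<sigma> *v x + abelianization p, j)) -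
     (\<Sum>(p, j, s) \<in> {(p, j, s). \<sigma> [Pos i] = p @ [Neg j] @ s}.
        E (incidence_matrix \<sigma> *v x + abelianization p - axis j 1, j)))"

lemma finite_occurrences:
  assumes "inj c"
  shows "finite {(p, j, s). w = p @ [c j] @ s}"
proof (rule finite_imageD)
  show "finite ((\<lambda>(p, j, s). length p) ` {(p, j, s). w = p @ [c j] @ s})"
    by (rule finite_subset[of _ "{..length w}"]) auto
  show "inj_on (\<lambda>(p, j, s). length p) {(p, j, s). w = p @ [c j] @ s}"
    using assms by (auto simp: inj_on_def)
qed


subsection \<open>Brun substitutions\<close>

definition brun_subst :: "nat \<Rightarrow> 'n \<Rightarrow> 'n \<Rightarrow> 'n word \<Rightarrow> 'n word" where
  "brun_subst a i j = endo (\<lambda>k.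
     if k = i then replicate a (Pos i) @ [Pos j]
     else if k = j then [Pos i]
     else [Pos k])"

definition brun_subst_inv :: "nat \<Rightarrow> 'n \<Rightarrow> 'n \<Rightarrow> 'n word \<Rightarrow> 'n word" where
  "brun_subst_inv a i j = inv_into (carrier free_group) (brun_subst a i j)"

lemma reduced_replicate: "reduced_word (replicate a (Pos i) @ [Pos j])"
  by (induction a) (auto simp: reduced_Cons hd_append)

lemma brun_subst_generators:
  assumes "i \<noteq> j"
  shows "brun_subst a i j [Pos i] = replicate a (Pos i) @ [Pos j]"
    and "brun_subst a i j [Pos j] = [Pos i]"
    and "k \<noteq> i \<Longrightarrow> k \<noteq> j \<Longrightarrow> brun_subst a i j [Pos k] = [Pos k]"
  unfolding brun_subst_def
  by (subst endo_generator; use assms in \<open>simp add: reduced_replicate\<close>)+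

lemma brun_subst_inv_generators:
  assumes "i \<noteq> j"
  shows "brun_subst_inv a i j [Pos i] = [Pos j]"
    and "brun_subst_inv a i j [Pos j] = replicate a (Neg j) @ [Pos i]"
    and "k \<noteq> i \<Longrightarrow> k \<noteq> j \<Longrightarrow> brun_subst_inv a i j [Pos k] = [Pos k]"
proof -
  define g where "g = (\<lambda>k. if k = i then replicate a (Pos i) @ [Pos j]
     else if k = j then [Pos i] else [Pos k])"
  define h where "h = (\<lambda>k. if k = i then [Pos j]
     else if k = j then replicate a (Neg j) @ [Pos i] else [Pos k])"
  have red: "reduced_word (replicate a (Neg j) @ [Pos i])"
    using assms by (induction a) (auto simp: reduced_Cons hd_append)
  have cm: "concat (replicate a [l]) = replicate a l" for l :: "'a letter"
    by (induction a) auto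
  have ri: "replicate a l = word_inv (replicate a (letter_inv l))" for l :: "'a letter"
    by (simp add: word_inv_def)
  have canc: "reduce (replicate a l @ replicate a (letter_inv l) @ v) = reduce v" for l :: "'a letter" and v
    using reduce_append_word_inv[of "replicate a l" v] by (simp add: word_inv_def)
  have "endo h (g k) = [Pos k]" for k
    using assms canc[of "Pos j" "[Pos i]"]
    by (auto simp: g_def endo_def h_def cm reduce_reduced)
  then have "endo h (endo g w) = w" if "reduced_word w" for w
    using that by (rule endo_left_inverse)
  then have inj: "inj_on (endo g) (carrier free_group)"
    by (intro inj_on_inverseI[of _ "endo h"]) (auto simp: free_group_def)
  have inv: "brun_subst_inv a i j v = w" if "endo g w = v" "reduced_word w" for v w
    using that inj unfolding brun_subst_inv_def brun_subst_def g_def[symmetric]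
    by (auto intro!: inv_into_f_eq simp: free_group_def)
  show "brun_subst_inv a i j [Pos i] = [Pos j]"
    using assms by (intro inv) (auto simp: endo_generator g_def)
  show "brun_subst_inv a i j [Pos j] = replicate a (Neg j) @ [Pos i]"
    using assms canc[of "Neg i" "[Pos j]"] red
    by (intro inv) (auto simp: endo_def g_def cm word_inv_def reduce_reduced)
  show "k \<noteq> i \<Longrightarrow> k \<noteq> j \<Longrightarrow> brun_subst_inv a i j [Pos k] = [Pos k]"
    by (intro inv) (auto simp: endo_generator g_def)
qed


subsection \<open>Runs and the map on binary stepped functions\<close>

definition int_interval :: "int set \<Rightarrow> bool" where
  "int_interval I \<longleftrightarrow> (\<forall>a\<in>I. \<forall>c\<in>I. {a..c} \<subseteq> I)"

text \<open>
  The possibly infinite sum of the faces \<open>(x + k e\<^sub>j, i\<^sup>*)\<close> for \<open>k \<in> I\<close> is taken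
  pointwise: at each point at most one summand is non-zero.
\<close>

definition face_line :: "'n \<Rightarrow> 'n \<Rightarrow> int ^ 'n \<Rightarrow> int set \<Rightarrow> 'n::finite stepped" where
  "face_line j i x I = (\<lambda>f.
     \<Sum>k | k \<in> I \<and> face (x + k *s axis j 1) i f \<noteq> 0. face (x + k *s axis j 1) i f)"

text \<open>\<open>is_run B j i x I\<close>: the function \<open>face_line j i x I\<close> is an \<open>(e\<^sub>j, i)\<close>-run of \<open>B\<close>.\<close>

definition is_run :: "'n stepped \<Rightarrow> 'n \<Rightarrow> 'n \<Rightarrow> int ^ 'n \<Rightarrow> int set \<Rightarrow> bool" where
  "is_run B j i x I \<longleftrightarrow>
     int_interval I \<and> face_line j i x I \<noteq> (\<lambda>f. 0) \<and> face_line j i x I \<le> B \<and>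
     (\<forall>J. int_interval J \<and> face_line j i x J \<le> B \<and> I \<subseteq> J \<longrightarrow> J = I)"

definition run_lengths :: "'n stepped \<Rightarrow> 'n \<Rightarrow> 'n::finite \<Rightarrow> enat set" where
  "run_lengths B j i =
     {if finite I then enat (card I) else \<infinity> | x I. is_run B j i x I}"

definition is_run_pair :: "'n stepped \<Rightarrow> 'n \<Rightarrow> 'n::finite \<Rightarrow> bool" where
  "is_run_pair B i j \<longleftrightarrow> i \<noteq> j \<and>
     (\<forall>k. k \<noteq> i \<longrightarrow> run_lengths B i k \<subseteq> {1} \<and> (k \<noteq> j \<longrightarrow> run_lengths B j k \<subseteq> {1})) \<and>
     (\<exists>n. enat n \<in> run_lengths B j i)"

definition run_map :: "'n stepped \<Rightarrow> 'n::{finite,linorder} stepped" where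
  "run_map B =
     (if \<exists>i j. is_run_pair B i j then
        let (i, j) = lex_least (is_run_pair B);
            a = (LEAST n. enat n \<in> run_lengths B j i)
        in dual_map (brun_subst_inv a i j) B
      else B)"

end

(*
  Along a line of direction e_j, the plane contains the face of type i at position m exactly when
  m alpha_j lies in a half-open interval of length alpha_i. Runs therefore have length the floor or
  the ceiling of alpha_i / alpha_j, and both occur. So condition (1) says that alpha_i and alpha_j
  are the two largest entries, condition (2) that both are positive, and the shortest run gives the
  partial quotient. The dual map of the inverse Brun substitution then acts on the plane as the
  transpose of its incidence matrix acts on the normal vector.
*)
theory Submission
  imports Defs
begin

subsection \<open>Runs of binary stepped functions\<close>

text \<open>The \<open>j\<close>-th coordinate recovers \<open>m\<close> from
  \<open>x + m *s axis j 1\<close>, so at any point at most one summand survives and the sum is an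
  indicator.\<close>

lemma face_line_apply:
  "face_line j i x I (y, k) = of_bool (k = i \<and> (\<exists>m\<in>I. y = x + m *s axis j 1))"
proof -
  have "m = m'" if "x + m *s axis j (1::int) = x + m' *s axis j 1" for m m'
  proof -
    have "(m *s axis j (1::int)) $ j = (m' *s axis j 1) $ j"
      using that by (metis add_left_imp_eq)
    then show ?thesis by simp
  qed
  then have eq: "{m \<in> I. face (x + m *s axis j 1) i (y, k) \<noteq> 0} = {m}"
    if "m \<in> I" "k = i" "y = x + m *s axis j 1" for m
    using that by (auto simp: face_def)
  show ?thesis
  proof (cases "k = i \<and> (\<exists>m\<in>I. y = x + m *s axis j 1)")
    case True
    then obtain m where "m \<in> I" "k = i" "y = x + m *s axis j 1" by blast
    then show ?thesis
      using eq[of m] by (auto simp: face_line_def) (simp add: face_def)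
  next
    case False
    then have "{m \<in> I. face (x + m *s axis j 1) i (y, k) \<noteq> 0} = {}"
      by (auto simp: face_def)
    then show ?thesis
      using False by (simp only: face_line_def) simp
  qed
qed

lemma face_line_eq_0_iff: "face_line j i x I = (\<lambda>f. 0) \<longleftrightarrow> I = {}"
  by (auto simp: fun_eq_iff face_line_apply)

lemma face_line_le_iff:
  assumes "binary B"
  shows "face_line j i x I \<le> B \<longleftrightarrow> (\<forall>m\<in>I. B (x + m *s axis j 1, i) = 1)"
proof -
  have B: "B f = 0 \<or> B f = 1" for f
    using assms by (auto simp: binary_def)
  have nonneg: "0 \<le> B f" for f using B[of f] by auto
  have one: "B f = 1" if "1 \<le> B f" for f using B[of f] that by auto
  show ?thesis
  proof
    assume *: "face_line j i x I \<le> B"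
    show "\<forall>m\<in>I. B (x + m *s axis j 1, i) = 1"
    proof
      fix m assume "m \<in> I"
      then have "face_line j i x I (x + m *s axis j 1, i) = 1"
        by (auto simp: face_line_apply)
      then show "B (x + m *s axis j 1, i) = 1"
        using le_funD[OF *, of "(x + m *s axis j 1, i)"] by (intro one) simp
    qed
  next
    assume "\<forall>m\<in>I. B (x + m *s axis j 1, i) = 1"
    then show "face_line j i x I \<le> B"
      by (auto simp: le_fun_def face_line_apply nonneg of_bool_def)
  qed
qed

text \<open>Every interval admissible for a run lies inside the support on the line. When that
  support is itself an interval, it is the only maximal one, so the line carries at most one
  run.\<close>

lemma is_run_iff_support:
  assumes "binary B" "int_interval {m. B (x + m *s axis j 1, i) = 1}"
  shows "is_run B j i x I \<longleftrightarrow> I = {m. B (x + m *s axis j 1, i) = 1} \<and> I \<noteq> {}"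
  using assms(2) unfolding is_run_def face_line_eq_0_iff face_line_le_iff[OF assms(1)]
  by blast


subsection \<open>Run lengths of stepped planes\<close>

lemma real_vec_add_scaled_axis:
  "real_vec (x + m *s axis j 1) \<bullet> \<alpha> = real_vec x \<bullet> \<alpha> + real_of_int m * \<alpha> $ j"
proof -
  have "real_vec (x + m *s axis j 1) = real_vec x + real_of_int m *\<^sub>R axis j 1"
    by (auto simp: real_vec_def vec_eq_iff axis_def)
  then show ?thesis
    by (simp add: inner_add_left inner_axis')
qed

lemma real_vec_add_axis: "real_vec (x + axis j 1) \<bullet> \<alpha> = real_vec x \<bullet> \<alpha> + \<alpha> $ j"
  using real_vec_add_scaled_axis[of x 1 j \<alpha>] by simp

lemma real_vec_scaled_axis: "real_vec (m *s axis j 1) \<bullet> \<alpha> = real_of_int m * \<alpha> $ j"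
proof -
  have "real_vec 0 \<bullet> \<alpha> = 0" by (simp add: real_vec_def inner_vec_def)
  then show ?thesis using real_vec_add_scaled_axis[of 0 m j \<alpha>] by simp
qed

text \<open>Positions on a line of direction \<open>e_j\<close> where the plane has a face of type
  \<open>i\<close>: \<open>u\<close> and \<open>v\<close> stand for \<open>\<alpha> $ j\<close> and
  \<open>\<alpha> $ i\<close>, and \<open>t\<close> for the height of the base point, its scalar
  product with \<alpha>.\<close>

definition strip :: "real \<Rightarrow> real \<Rightarrow> real \<Rightarrow> real \<Rightarrow> int set" where
  "strip \<rho> u v t = {m. t + real_of_int m * u < \<rho> \<and> \<rho> \<le> t + real_of_int m * u + v}"

text \<open>Since \<open>\<alpha> $ j\<close> is nonnegative, height is monotone along the line, so
  each nonempty strip is an interval and hence the run of its line.\<close>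

lemma run_lengths_stepped_plane:
  assumes "\<alpha> $ j \<ge> 0"
  shows "run_lengths (stepped_plane \<alpha> \<rho>) j i =
    (\<lambda>S. if finite S then enat (card S) else \<infinity>) `
      (range (\<lambda>x. strip \<rho> (\<alpha> $ j) (\<alpha> $ i) (real_vec x \<bullet> \<alpha>)) - {{}})"
proof -
  have supp: "{m. stepped_plane \<alpha> \<rho> (x + m *s axis j 1, i) = 1}
      = strip \<rho> (\<alpha> $ j) (\<alpha> $ i) (real_vec x \<bullet> \<alpha>)" for x
    by (auto simp: stepped_plane_def strip_def real_vec_add_axis real_vec_add_scaled_axis
        split: if_splits)
  have "int_interval (strip \<rho> (\<alpha> $ j) (\<alpha> $ i) t)" for t
    unfolding int_interval_def strip_def
  proof (intro ballI subsetI, clarify)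
    fix a c m :: int
    assume *: "\<rho> \<le> t + a * \<alpha> $ j + \<alpha> $ i" "t + c * \<alpha> $ j < \<rho>" "m \<in> {a..c}"
    then have "a * \<alpha> $ j \<le> m * \<alpha> $ j" "m * \<alpha> $ j \<le> c * \<alpha> $ j"
      using assms by (auto intro!: mult_right_mono)
    with * show "t + m * \<alpha> $ j < \<rho> \<and> \<rho> \<le> t + m * \<alpha> $ j + \<alpha> $ i" by linarith
  qed
  then have "is_run (stepped_plane \<alpha> \<rho>) j i x I \<longleftrightarrow>
      I = strip \<rho> (\<alpha> $ j) (\<alpha> $ i) (real_vec x \<bullet> \<alpha>) \<and> I \<noteq> {}" for x I
    by (subst is_run_iff_support) (simp_all add: binary_stepped_plane supp)
  then show ?thesis
    unfolding run_lengths_def image_def by (simp only:) blast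
qed

section \<open>Strip lengths and their two roundings\<close>

lemma strip_eq_atLeastLessThan:
  assumes "u > 0"
  shows "strip \<rho> u v t = {\<lceil>(\<rho> - t - v) / u\<rceil>..<\<lceil>(\<rho> - t) / u\<rceil>}"
  using assms
  by (auto simp: strip_def ceiling_le_iff less_ceiling_iff field_simps)

text \<open>The bound \<open>v \<ge> 0\<close> keeps the endpoints of the interval ordered, so the
  cardinality is their integer difference without truncation.\<close>

lemma card_strip:
  assumes "u > 0" "v \<ge> 0"
  shows "int (card (strip \<rho> u v t)) = \<lceil>(\<rho> - t) / u\<rceil> - \<lceil>(\<rho> - t) / u - v / u\<rceil>"
proof -
  have "(\<rho> - t) / u - v / u \<le> (\<rho> - t) / u"
    using assms by simp
  then have "\<lceil>(\<rho> - t) / u - v / u\<rceil> \<le> \<lceil>(\<rho> - t) / u\<rceil>"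
    by (rule ceiling_mono)
  then show ?thesis
    using assms by (simp add: strip_eq_atLeastLessThan diff_divide_distrib)
qed

lemma floor_le_card_strip:
  assumes "u > 0" "v \<ge> 0"
  shows "\<lfloor>v / u\<rfloor> \<le> int (card (strip \<rho> u v t))"
  unfolding card_strip[OF assms] by linarith

lemma card_strip_le_ceiling:
  assumes "u > 0" "v \<ge> 0"
  shows "int (card (strip \<rho> u v t)) \<le> \<lceil>v / u\<rceil>"
  unfolding card_strip[OF assms] by linarith

text \<open>By telescoping: if every difference exceeded \<open>\<lfloor>r\<rfloor>\<close>, the
  ceilings would drop by at least \<open>\<lfloor>r\<rfloor> + 1\<close> per step, while
  \<open>s - m * r\<close> itself drops only by the smaller amount \<open>r\<close>.\<close>

lemma ceiling_diff_attains_floor: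
  fixes s r :: real
  shows "\<exists>m::nat. \<lceil>s - m * r\<rceil> - \<lceil>s - m * r - r\<rceil> \<le> \<lfloor>r\<rfloor>"
proof (rule ccontr)
  assume "\<not> ?thesis"
  then have step: "\<lceil>s - m * r - r\<rceil> \<le> \<lceil>s - m * r\<rceil> - (\<lfloor>r\<rfloor> + 1)" for m :: nat
    by (auto simp: not_le) (smt (verit))
  have sum: "\<lceil>s - N * r\<rceil> \<le> \<lceil>s\<rceil> - int N * (\<lfloor>r\<rfloor> + 1)" for N
  proof (induction N)
    case (Suc N)
    have "s - real (Suc N) * r = s - N * r - r" by (simp add: algebra_simps)
    then show ?case using Suc step[of N] by (simp add: algebra_simps)
  qed simp
  have pos: "0 < real_of_int \<lfloor>r\<rfloor> + 1 - r" by linarith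
  \<comment> \<open>The accumulated gap has to exceed 1, because rounding \<open>s\<close> up adds
    less than 1.\<close>
  obtain N :: nat where N: "1 < N * (real_of_int \<lfloor>r\<rfloor> + 1 - r)"
    using reals_Archimedean3[OF pos] by blast
  have "s - N * r \<le> \<lceil>s - N * r\<rceil>" by linarith
  also have "\<dots> \<le> \<lceil>s\<rceil> - real N * (\<lfloor>r\<rfloor> + 1)"
    using of_int_le_iff[THEN iffD2, OF sum[of N]] by (simp only: of_int_diff of_int_mult of_int_add of_int_1 of_int_of_nat_eq)
  also have "\<dots> < s + 1 - real N * (\<lfloor>r\<rfloor> + 1)" by linarith
  finally show False using N by (simp add: algebra_simps)
qed

text \<open>The mirror image: differences all below \<open>\<lceil>r\<rceil>\<close> would let the
  ceilings drop by at most \<open>\<lceil>r\<rceil> - 1 < r\<close> per step, too slowly to follow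
  \<open>s - m * r\<close>.\<close>

lemma ceiling_diff_attains_ceiling:
  fixes s r :: real
  shows "\<exists>m::nat. \<lceil>r\<rceil> \<le> \<lceil>s - m * r\<rceil> - \<lceil>s - m * r - r\<rceil>"
proof (rule ccontr)
  assume "\<not> ?thesis"
  then have step: "\<lceil>s - m * r\<rceil> - (\<lceil>r\<rceil> - 1) \<le> \<lceil>s - m * r - r\<rceil>" for m :: nat
    by (auto simp: not_le) (smt (verit))
  have sum: "\<lceil>s\<rceil> - int N * (\<lceil>r\<rceil> - 1) \<le> \<lceil>s - N * r\<rceil>" for N
  proof (induction N)
    case (Suc N)
    have "s - real (Suc N) * r = s - N * r - r" by (simp add: algebra_simps)
    then show ?case using Suc step[of N] by (simp add: algebra_simps)
  qed simp
  have pos: "0 < r - (real_of_int \<lceil>r\<rceil> - 1)" by linarith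
  obtain N :: nat where N: "1 < N * (r - (real_of_int \<lceil>r\<rceil> - 1))"
    using reals_Archimedean3[OF pos] by blast
  have "s - real N * (\<lceil>r\<rceil> - 1) \<le> \<lceil>s\<rceil> - real N * (\<lceil>r\<rceil> - 1)" by linarith
  also have "\<dots> \<le> \<lceil>s - N * r\<rceil>"
    using of_int_le_iff[THEN iffD2, OF sum[of N]] by (simp only: of_int_diff of_int_mult of_int_add of_int_1 of_int_of_nat_eq)
  also have "\<dots> < s - N * r + 1" by linarith
  finally show False using N by (simp add: algebra_simps)
qed

text \<open>
  The strips based at the multiples of \<open>e\<^sub>i\<close> are consecutive: together they cover a line of
  direction \<open>e\<^sub>j\<close> without overlap, so their average length is \<open>\<alpha>\<^sub>i / \<alpha>\<^sub>j\<close>.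
  Hence both roundings of this quotient occur as lengths, whatever the intercept.
\<close>

lemma ex_card_strip_le_floor:
  assumes "\<alpha> $ j > 0" "\<alpha> $ i \<ge> 0"
  shows "\<exists>x. int (card (strip \<rho> (\<alpha> $ j) (\<alpha> $ i) (real_vec x \<bullet> \<alpha>))) \<le> \<lfloor>\<alpha> $ i / \<alpha> $ j\<rfloor>"
proof -
  obtain m :: nat where
    "\<lceil>\<rho> / \<alpha> $ j - m * (\<alpha> $ i / \<alpha> $ j)\<rceil> - \<lceil>\<rho> / \<alpha> $ j - m * (\<alpha> $ i / \<alpha> $ j) - \<alpha> $ i / \<alpha> $ j\<rceil>
      \<le> \<lfloor>\<alpha> $ i / \<alpha> $ j\<rfloor>"
    using ceiling_diff_attains_floor by blast
  then show ?thesis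
    using assms
    by (intro exI[of _ "int m *s axis i 1"])
      (simp add: card_strip real_vec_scaled_axis diff_divide_distrib)
qed

lemma ex_ceiling_le_card_strip:
  assumes "\<alpha> $ j > 0" "\<alpha> $ i \<ge> 0"
  shows "\<exists>x. \<lceil>\<alpha> $ i / \<alpha> $ j\<rceil> \<le> int (card (strip \<rho> (\<alpha> $ j) (\<alpha> $ i) (real_vec x \<bullet> \<alpha>)))"
proof -
  obtain m :: nat where
    "\<lceil>\<alpha> $ i / \<alpha> $ j\<rceil> \<le>
      \<lceil>\<rho> / \<alpha> $ j - m * (\<alpha> $ i / \<alpha> $ j)\<rceil> - \<lceil>\<rho> / \<alpha> $ j - m * (\<alpha> $ i / \<alpha> $ j) - \<alpha> $ i / \<alpha> $ j\<rceil>"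
    using ceiling_diff_attains_ceiling by blast
  then show ?thesis
    using assms
    by (intro exI[of _ "int m *s axis i 1"])
      (simp add: card_strip real_vec_scaled_axis diff_divide_distrib)
qed

section \<open>Run conditions as comparisons of entries\<close>

lemma finite_strip: "u > 0 \<Longrightarrow> finite (strip \<rho> u v t)"
  by (simp add: strip_eq_atLeastLessThan)

lemma strip_height_0: "strip \<rho> u 0 t = {}"
  by (auto simp: strip_def)

lemma strip_direction_0: "strip \<rho> 0 v t = (if t < \<rho> \<and> \<rho> \<le> t + v then UNIV else {})"
  by (auto simp: strip_def)

lemma run_lengths_pos:
  assumes "\<alpha> $ j > 0"
  shows "run_lengths (stepped_plane \<alpha> \<rho>) j i =
    {enat (card S) | S. S \<in> range (\<lambda>x. strip \<rho> (\<alpha> $ j) (\<alpha> $ i) (real_vec x \<bullet> \<alpha>)) \<and> S \<noteq> {}}"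
proof -
  have "(if finite S then enat (card S) else \<infinity>) = enat (card S)"
    if "S \<in> range (\<lambda>x. strip \<rho> (\<alpha> $ j) (\<alpha> $ i) (real_vec x \<bullet> \<alpha>))" for S
    using that finite_strip[OF assms] by auto
  then show ?thesis
    unfolding run_lengths_stepped_plane[OF less_imp_le[OF assms]]
    by (auto simp: image_iff Bex_def)
qed

text \<open>This translates condition (1). For \<open>\<alpha> $ j > 0\<close> the greatest strip
  length is \<open>\<lceil>\<alpha> $ i / \<alpha> $ j\<rceil>\<close>. For
  \<open>\<alpha> $ j = 0\<close> all runs are infinite, and one exists exactly when
  \<open>\<alpha> $ i > 0\<close>.\<close>

lemma run_lengths_subset_1_iff:
  assumes "\<And>k. \<alpha> $ k \<ge> 0"
  shows "run_lengths (stepped_plane \<alpha> \<rho>) j i \<subseteq> {1} \<longleftrightarrow> \<alpha> $ i \<le> \<alpha> $ j"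
proof (cases "\<alpha> $ j = 0")
  case True
  show ?thesis
  proof (cases "\<alpha> $ i = 0")
    case True
    then show ?thesis
      using assms by (subst run_lengths_stepped_plane) (auto simp: strip_height_0)
  next
    case False
    then have pos: "\<alpha> $ i > 0" using assms[of i] by simp
    \<comment> \<open>The largest integer with \<open>m * \<alpha> $ i < \<rho>\<close>. As
      \<open>\<alpha> $ j = 0\<close>, the line through \<open>m *s axis i 1\<close> has this
      constant height, and all its faces of type \<open>i\<close> lie in the plane.\<close>
    define m where "m = \<lceil>\<rho> / \<alpha> $ i\<rceil> - 1"
    have "real_of_int m < \<rho> / \<alpha> $ i" "\<rho> / \<alpha> $ i \<le> real_of_int m + 1"
      unfolding m_def by linarith+
    then have "strip \<rho> 0 (\<alpha> $ i) (real_vec (m *s axis i 1) \<bullet> \<alpha>) = UNIV"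
      using pos by (simp add: strip_direction_0 real_vec_scaled_axis field_simps)
    then have "UNIV \<in> range (\<lambda>x. strip \<rho> (\<alpha> $ j) (\<alpha> $ i) (real_vec x \<bullet> \<alpha>)) - {{}}"
      using True by (metis Diff_iff UNIV_not_empty rangeI singletonD)
    then have "\<infinity> \<in> run_lengths (stepped_plane \<alpha> \<rho>) j i"
      unfolding run_lengths_stepped_plane[OF assms]
      by (intro image_eqI[of _ _ "UNIV :: int set"]) auto
    then have "\<not> run_lengths (stepped_plane \<alpha> \<rho>) j i \<subseteq> {1}"
      by (auto simp: one_enat_def)
    then show ?thesis using pos True by simp
  qed
next
  case False
  then have pos: "\<alpha> $ j > 0" using assms[of j] by simp
  show ?thesis
  proof
    assume *: "run_lengths (stepped_plane \<alpha> \<rho>) j i \<subseteq> {1}"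
    obtain x where x: "\<lceil>\<alpha> $ i / \<alpha> $ j\<rceil> \<le> int (card (strip \<rho> (\<alpha> $ j) (\<alpha> $ i) (real_vec x \<bullet> \<alpha>)))"
      using ex_ceiling_le_card_strip[OF pos assms] by blast
    have "card (strip \<rho> (\<alpha> $ j) (\<alpha> $ i) (real_vec x \<bullet> \<alpha>)) \<le> 1"
    proof (cases "strip \<rho> (\<alpha> $ j) (\<alpha> $ i) (real_vec x \<bullet> \<alpha>) = {}")
      case False
      then have "enat (card (strip \<rho> (\<alpha> $ j) (\<alpha> $ i) (real_vec x \<bullet> \<alpha>))) = 1"
        using * unfolding run_lengths_pos[OF pos] by blast
      then show ?thesis by (simp add: one_enat_def)
    qed simp
    with x have "\<lceil>\<alpha> $ i / \<alpha> $ j\<rceil> \<le> 1" by linarith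
    then show "\<alpha> $ i \<le> \<alpha> $ j"
      using pos by (simp add: ceiling_le_iff)
  next
    assume "\<alpha> $ i \<le> \<alpha> $ j"
    then have c: "\<lceil>\<alpha> $ i / \<alpha> $ j\<rceil> \<le> 1"
      using pos by (simp add: ceiling_le_iff)
    have "card (strip \<rho> (\<alpha> $ j) (\<alpha> $ i) t) = 1" if "strip \<rho> (\<alpha> $ j) (\<alpha> $ i) t \<noteq> {}" for t
    proof -
      have "card (strip \<rho> (\<alpha> $ j) (\<alpha> $ i) t) > 0"
        using that finite_strip[OF pos] by (simp add: card_gt_0_iff)
      then show ?thesis
        using c card_strip_le_ceiling[OF pos assms, of \<rho> i t] by linarith
    qed
    then show "run_lengths (stepped_plane \<alpha> \<rho>) j i \<subseteq> {1}"
      unfolding run_lengths_pos[OF pos] by (auto simp: one_enat_def)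
  qed
qed

text \<open>This translates condition (2): without \<open>\<alpha> $ i > 0\<close> there are no
  faces of type \<open>i\<close>, and without \<open>\<alpha> $ j > 0\<close> every run is
  infinite.\<close>

lemma finite_run_iff:
  assumes "\<And>k. \<alpha> $ k \<ge> 0"
  shows "(\<exists>n. enat n \<in> run_lengths (stepped_plane \<alpha> \<rho>) j i) \<longleftrightarrow> \<alpha> $ i > 0 \<and> \<alpha> $ j > 0"
proof
  assume "\<exists>n. enat n \<in> run_lengths (stepped_plane \<alpha> \<rho>) j i"
  then obtain x where "finite (strip \<rho> (\<alpha> $ j) (\<alpha> $ i) (real_vec x \<bullet> \<alpha>))"
    "strip \<rho> (\<alpha> $ j) (\<alpha> $ i) (real_vec x \<bullet> \<alpha>) \<noteq> {}"
    unfolding run_lengths_stepped_plane[OF assms] by (auto split: if_splits)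
  then have "\<alpha> $ i \<noteq> 0" "\<alpha> $ j \<noteq> 0"
    using strip_height_0 strip_direction_0 infinite_UNIV_int by metis+
  then show "\<alpha> $ i > 0 \<and> \<alpha> $ j > 0"
    using assms by (metis order_le_less)
next
  assume *: "\<alpha> $ i > 0 \<and> \<alpha> $ j > 0"
  then have "\<lceil>\<alpha> $ i / \<alpha> $ j\<rceil> > 0" by simp
  moreover obtain x where "\<lceil>\<alpha> $ i / \<alpha> $ j\<rceil> \<le> int (card (strip \<rho> (\<alpha> $ j) (\<alpha> $ i) (real_vec x \<bullet> \<alpha>)))"
    using ex_ceiling_le_card_strip * assms by blast
  ultimately have "strip \<rho> (\<alpha> $ j) (\<alpha> $ i) (real_vec x \<bullet> \<alpha>) \<noteq> {}"
    by auto
  then show "\<exists>n. enat n \<in> run_lengths (stepped_plane \<alpha> \<rho>) j i"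
    using * by (auto simp: run_lengths_pos)
qed

text \<open>The floor bounds every strip length from below and is attained. By
  \<open>\<alpha> $ j \<le> \<alpha> $ i\<close> it is at least 1, so the strip attaining it is
  nonempty and counts as a run.\<close>

lemma shortest_run_length:
  assumes "\<alpha> $ j > 0" "\<alpha> $ j \<le> \<alpha> $ i"
  shows "(LEAST n. enat n \<in> run_lengths (stepped_plane \<alpha> \<rho>) j i) = nat \<lfloor>\<alpha> $ i / \<alpha> $ j\<rfloor>"
proof -
  have nonneg: "\<alpha> $ i \<ge> 0" using assms by simp
  have fl: "\<lfloor>\<alpha> $ i / \<alpha> $ j\<rfloor> \<ge> 1"
    using assms by (simp add: le_floor_iff)
  obtain x where x: "int (card (strip \<rho> (\<alpha> $ j) (\<alpha> $ i) (real_vec x \<bullet> \<alpha>))) \<le> \<lfloor>\<alpha> $ i / \<alpha> $ j\<rfloor>"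
    using ex_card_strip_le_floor[OF assms(1) nonneg] by blast
  have lower: "\<lfloor>\<alpha> $ i / \<alpha> $ j\<rfloor> \<le> int (card (strip \<rho> (\<alpha> $ j) (\<alpha> $ i) t))" for t
    by (rule floor_le_card_strip[OF assms(1) nonneg])
  have card: "card (strip \<rho> (\<alpha> $ j) (\<alpha> $ i) (real_vec x \<bullet> \<alpha>)) = nat \<lfloor>\<alpha> $ i / \<alpha> $ j\<rfloor>"
    using x lower[of "real_vec x \<bullet> \<alpha>"] by simp
  then have "strip \<rho> (\<alpha> $ j) (\<alpha> $ i) (real_vec x \<bullet> \<alpha>) \<noteq> {}"
    using fl by auto
  show ?thesis
  proof (rule Least_equality)
    show "enat (nat \<lfloor>\<alpha> $ i / \<alpha> $ j\<rfloor>) \<in> run_lengths (stepped_plane \<alpha> \<rho>) j i"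
      unfolding run_lengths_pos[OF assms(1)] card[symmetric] using \<open>_ \<noteq> {}\<close> by blast
    show "nat \<lfloor>\<alpha> $ i / \<alpha> $ j\<rfloor> \<le> n" if "enat n \<in> run_lengths (stepped_plane \<alpha> \<rho>) j i" for n
      using that lower unfolding run_lengths_pos[OF assms(1)] by (auto simp: nat_le_iff)
  qed
qed


subsection \<open>Brun pairs\<close>

lemma is_brun_pair_iff:
  "is_brun_pair \<alpha> i j \<longleftrightarrow> i \<noteq> j \<and> (\<forall>k. \<alpha> $ k \<le> \<alpha> $ i) \<and> (\<forall>k. k \<noteq> i \<longrightarrow> \<alpha> $ k \<le> \<alpha> $ j)"
proof -
  have "\<alpha> $ i = Max (range (\<lambda>k. \<alpha> $ k)) \<longleftrightarrow> (\<forall>k. \<alpha> $ k \<le> \<alpha> $ i)"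
    by (subst eq_commute, subst Max_eq_iff) auto
  moreover have "\<alpha> $ j = Max ((\<lambda>k. \<alpha> $ k) ` (UNIV - {i})) \<longleftrightarrow> (\<forall>k. k \<noteq> i \<longrightarrow> \<alpha> $ k \<le> \<alpha> $ j)"
    if "i \<noteq> j"
    using that by (subst eq_commute, subst Max_eq_iff) auto
  ultimately show ?thesis
    unfolding is_brun_pair_def by blast
qed

text \<open>Runs along \<open>e_i\<close> make \<open>\<alpha> $ i\<close> the maximum, and runs
  along \<open>e_j\<close> make \<open>\<alpha> $ j\<close> the maximum of the rest. Positivity of
  \<open>\<alpha> $ i\<close> then follows from that of \<open>\<alpha> $ j\<close>.\<close>

lemma is_run_pair_stepped_plane:
  assumes "\<And>k. \<alpha> $ k \<ge> 0"
  shows "is_run_pair (stepped_plane \<alpha> \<rho>) i j \<longleftrightarrow> is_brun_pair \<alpha> i j \<and> \<alpha> $ j > 0"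
  unfolding is_run_pair_def is_brun_pair_iff run_lengths_subset_1_iff[OF assms] finite_run_iff[OF assms]
  by (metis order_refl order_less_le_trans)

lemma ex_brun_pair:
  fixes \<alpha> :: "real ^ 'n::finite"
  assumes "k \<noteq> (l :: 'n)"
  shows "\<exists>i j. is_brun_pair \<alpha> i j"
proof -
  have "Max (range (\<lambda>k. \<alpha> $ k)) \<in> range (\<lambda>k. \<alpha> $ k)"
    by (intro Max_in) auto
  then obtain i where i: "\<alpha> $ i = Max (range (\<lambda>k. \<alpha> $ k))" by (metis imageE)
  \<comment> \<open>The second maximum ranges over a nonempty set because there are two distinct
    indices.\<close>
  have "UNIV - {i} \<noteq> {}" using assms by (metis Diff_iff UNIV_I empty_iff singletonD)
  then have "Max ((\<lambda>k. \<alpha> $ k) ` (UNIV - {i})) \<in> (\<lambda>k. \<alpha> $ k) ` (UNIV - {i})"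
    by (intro Max_in) auto
  then show ?thesis
    unfolding is_brun_pair_def using i by fastforce
qed

text \<open>The second largest entry vanishes exactly when \<alpha> lies on a coordinate axis; this
  matches the default cases of the two maps.\<close>

lemma brun_pair_pos_iff:
  assumes "\<And>k. \<alpha> $ k \<ge> 0" "\<alpha> \<noteq> 0" "is_brun_pair \<alpha> i j"
  shows "\<alpha> $ j > 0 \<longleftrightarrow> \<alpha> \<notin> {l *\<^sub>R axis i 1 | l i. l > 0}"
proof
  assume "\<alpha> $ j > 0"
  moreover have "\<alpha> $ i \<ge> \<alpha> $ j" "i \<noteq> j" using assms(3) by (auto simp: is_brun_pair_iff)
  ultimately show "\<alpha> \<notin> {l *\<^sub>R axis i 1 | l i. l > 0}"
    by (auto simp: axis_def split: if_splits)
next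
  assume *: "\<alpha> \<notin> {l *\<^sub>R axis i 1 | l i. l > 0}"
  show "\<alpha> $ j > 0"
  proof (rule ccontr)
    assume "\<not> \<alpha> $ j > 0"
    then have zero: "\<alpha> $ k = 0" if "k \<noteq> i" for k
      using that assms(1)[of k] assms(3) unfolding is_brun_pair_iff by fastforce
    then have eq: "\<alpha> = \<alpha> $ i *\<^sub>R axis i 1"
      by (auto simp: vec_eq_iff axis_def)
    then have "\<alpha> $ i > 0"
      using assms(1)[of i] assms(2) by (metis order_le_less scaleR_zero_left)
    then show False using eq * by blast
  qed
qed


subsection \<open>The Brun map and the dual map\<close>

text \<open>The link between the two sides: both the inverse Brun matrix and the transposed
  incidence matrix of the inverse substitution send \<alpha> to this vector. The reduced entry lands
  at \<open>j\<close>, not at \<open>i\<close>.\<close>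

definition brun_step :: "real ^ 'n \<Rightarrow> 'n::finite \<Rightarrow> 'n \<Rightarrow> int \<Rightarrow> real ^ 'n" where
  "brun_step \<alpha> i j a =
     (\<chi> k. if k = i then \<alpha> $ j else if k = j then \<alpha> $ i - of_int a * \<alpha> $ j else \<alpha> $ k)"

lemma brun_elementary_vector_mult:
  assumes "i \<noteq> j"
  shows "brun_elementary a i j *v y =
    (\<chi> k. if k = i then of_int a * y $ i + y $ j else if k = j then y $ i else y $ k)"
proof -
  have "(brun_elementary a i j *v y) $ k =
    (if k = i then of_int a * y $ i + y $ j else if k = j then y $ i else y $ k)" for k
  proof -
    \<comment> \<open>Row \<open>k\<close> is supported on columns \<open>i\<close>,
      \<open>j\<close> and \<open>k\<close>; the third sum is 0 for \<open>k\<close> in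
      \<open>{i, j}\<close>, so that no entry counts twice.\<close>
    have "(\<Sum>c\<in>UNIV. brun_elementary a i j $ k $ c * y $ c) =
      (\<Sum>c\<in>UNIV. if c = i then brun_elementary a i j $ k $ i * y $ i else 0) +
      (\<Sum>c\<in>UNIV. if c = j then brun_elementary a i j $ k $ j * y $ j else 0) +
      (\<Sum>c\<in>UNIV. if c = k then (if k = i \<or> k = j then 0 else y $ k) else 0)"
      unfolding sum.distrib[symmetric] using assms
      by (intro sum.cong) (auto simp: brun_elementary_def)
    then show ?thesis
      using assms by (auto simp: matrix_vector_mult_def brun_elementary_def)
  qed
  then show ?thesis by (simp add: vec_eq_iff)
qed

text \<open>\<open>matrix_inv\<close> is defined by choice, so its equations come from the existence
  of an inverse.\<close>

lemma matrix_inv_vector_mult: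
  fixes A :: "real ^ 'n ^ 'n"
  assumes "invertible A"
  shows "matrix_inv A *v (A *v x) = x"
proof -
  have "A ** matrix_inv A = mat 1 \<and> matrix_inv A ** A = mat 1"
    using assms unfolding invertible_def matrix_inv_def by (rule someI_ex)
  then show ?thesis by (simp add: matrix_vector_mul_assoc)
qed

lemma matrix_inv_mat_1_vector_mult: "matrix_inv (mat 1) *v x = (x :: real ^ 'n)"
proof -
  have "invertible (mat 1 :: real ^ 'n ^ 'n)"
    by (auto simp: invertible_def)
  then show ?thesis
    using matrix_inv_vector_mult[of "mat 1" x] by simp
qed

text \<open>Invertibility comes from injectivity, read off coordinatewise; it then suffices that
  \<open>brun_step\<close> is a preimage of \<alpha>.\<close>

lemma matrix_inv_brun_elementary:
  fixes \<alpha> :: "real ^ 'n::finite"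
  assumes "i \<noteq> j"
  shows "matrix_inv (brun_elementary a i j) *v \<alpha> = brun_step \<alpha> i j a"
proof -
  let ?B = "brun_elementary a i j :: real ^ 'n ^ 'n"
  have "inj ((*v) ?B)"
  proof (rule injI)
    fix y z assume "?B *v y = ?B *v z"
    then have eq: "(?B *v y) $ k = (?B *v z) $ k" for k by simp
    have "y $ k = z $ k" for k
      using eq[of k] eq[of i] eq[of j] assms
      by (auto simp: brun_elementary_vector_mult split: if_splits)
    then show "y = z" by (simp add: vec_eq_iff)
  qed
  then have "invertible ?B"
    by (simp add: invertible_left_inverse matrix_left_invertible_injective)
  moreover have "?B *v brun_step \<alpha> i j a = \<alpha>"
    using assms by (simp add: brun_elementary_vector_mult brun_step_def vec_eq_iff)
  ultimately show ?thesis
    by (metis matrix_inv_vector_mult)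
qed

text \<open>The adjoint identity: the vector on the right is the transposed incidence matrix applied
  to \<alpha>.\<close>

lemma incidence_matrix_inner:
  "real_vec (incidence_matrix \<sigma> *v x) \<bullet> \<alpha> =
    real_vec x \<bullet> (\<chi> c. real_vec (abelianization (\<sigma> [Pos c])) \<bullet> \<alpha>)"
proof -
  have "real_vec (incidence_matrix \<sigma> *v x) \<bullet> \<alpha> =
    (\<Sum>r\<in>UNIV. \<Sum>c\<in>UNIV. real_of_int (abelianization (\<sigma> [Pos c]) $ r) * x $ c * \<alpha> $ r)"
    by (simp add: inner_vec_def real_vec_def matrix_vector_mult_def incidence_matrix_def sum_distrib_right)
  also have "\<dots> = (\<Sum>c\<in>UNIV. \<Sum>r\<in>UNIV. real_of_int (abelianization (\<sigma> [Pos c]) $ r) * x $ c * \<alpha> $ r)"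
    by (rule sum.swap)
  also have "\<dots> = real_vec x \<bullet> (\<chi> c. real_vec (abelianization (\<sigma> [Pos c])) \<bullet> \<alpha>)"
    by (simp add: inner_vec_def real_vec_def sum_distrib_left mult_ac)
  finally show ?thesis .
qed

lemma count_list_replicate: "count_list (replicate a l) m = (if l = m then a else 0)"
  by (induction a) auto

lemma abelianization_simps:
  "abelianization [] = 0"
  "abelianization [Pos k] = axis k 1"
  "abelianization (replicate a (Neg j)) = - int a *s axis j 1"
  "abelianization (u @ v) = abelianization u + abelianization v"
  by (auto simp: abelianization_def vec_eq_iff axis_def count_list_replicate)

lemma incidence_matrix_brun_inner:
  assumes "i \<noteq> j"
  shows "real_vec (incidence_matrix (brun_subst_inv a i j) *v x) \<bullet> \<alpha> = real_vec x \<bullet> brun_step \<alpha> i j a"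
proof -
  have axis: "real_vec (axis k 1) \<bullet> \<alpha> = \<alpha> $ k" for k
    using real_vec_scaled_axis[of 1 k \<alpha>] by simp
  have "real_vec (abelianization (brun_subst_inv a i j [Pos c])) \<bullet> \<alpha> = brun_step \<alpha> i j a $ c" for c
  proof -
    consider "c = i" | "c = j" | "c \<noteq> i" "c \<noteq> j" by blast
    then show ?thesis
    proof cases
      case 2
      have "real_vec (abelianization (replicate a (Neg j) @ [Pos i])) \<bullet> \<alpha>
        = real_vec (axis i 1 + (- int a) *s axis j 1) \<bullet> \<alpha>"
        by (simp add: abelianization_simps add.commute)
      also have "\<dots> = \<alpha> $ i - real a * \<alpha> $ j"
        by (subst real_vec_add_scaled_axis) (simp add: axis)
      finally show ?thesis
        using 2 assms by (simp add: brun_subst_inv_generators brun_step_def)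
    qed (use assms in \<open>simp_all add: brun_subst_inv_generators brun_step_def abelianization_simps axis\<close>)
  qed
  then show ?thesis
    by (simp add: incidence_matrix_inner)
qed

section \<open>Letter occurrences in the images of generators\<close>

lemma occurrences_single:
  "{(p, j, s). [Pos k] = p @ [Pos j] @ s} = {([], k, [])}"
  "{(p, j, s). [Pos k] = p @ [Neg j] @ s} = {}"
  by (auto simp: Cons_eq_append_conv)

lemma occurrences_Pos:
  "{(p, k, s). replicate a (Neg j) @ [Pos i] = p @ [Pos k] @ s} = {(replicate a (Neg j), i, [])}"
proof -
  have "p = replicate a (Neg j) \<and> k = i \<and> s = []"
    if "replicate a (Neg j) @ [Pos i] = p @ [Pos k] @ s" for p k s
    using that
  proof (induction a arbitrary: p)
    case 0
    then show ?case by (auto simp: Cons_eq_append_conv)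
  next
    case (Suc a)
    then show ?case by (cases p) auto
  qed
  then show ?thesis by auto
qed

text \<open>Indexing by the number \<open>m\<close> of preceding letters turns the sum over
  occurrences into one over \<open>{..<a}\<close>.\<close>

lemma occurrences_Neg:
  "{(p, k, s). replicate a (Neg j) @ [Pos i] = p @ [Neg k] @ s} =
    (\<lambda>m. (replicate m (Neg j), j, replicate (a - Suc m) (Neg j) @ [Pos i])) ` {..<a}"
    (is "?L = ?R")
proof -
  have "(p, k, s) \<in> ?R" if "replicate a (Neg j) @ [Pos i] = p @ [Neg k] @ s" for p k s
    using that
  proof (induction a arbitrary: p)
    case 0
    then show ?case by (auto simp: Cons_eq_append_conv)
  next
    case (Suc a)
    show ?case
    proof (cases p)
      case Nil
      then show ?thesis using Suc.prems by (intro image_eqI[of _ _ 0]) auto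
    next
      case (Cons l q)
      then obtain m where "m < a" "(q, k, s) = (replicate m (Neg j), j, replicate (a - Suc m) (Neg j) @ [Pos i])"
        using Suc.IH[of q] Suc.prems by auto
      then show ?thesis
        using Cons Suc.prems by (intro image_eqI[of _ _ "Suc m"]) auto
    qed
  qed
  moreover have "replicate a (Neg j) @ [Pos i] =
      replicate m (Neg j) @ [Neg j] @ replicate (a - Suc m) (Neg j) @ [Pos i]" if "m < a" for m
  proof -
    have "replicate a (Neg j) = replicate m (Neg j) @ replicate (Suc (a - Suc m)) (Neg j)"
      using that by (simp add: replicate_add[symmetric] del: replicate_Suc)
    then show ?thesis by simp
  qed
  ultimately show ?thesis by auto
qed

text \<open>
  Written as a difference of indicators, the stepped plane turns the sums defining the dual map
  into telescoping ones.
\<close>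

lemma stepped_plane_apply:
  assumes "\<alpha> $ i \<ge> 0"
  shows "stepped_plane \<alpha> \<rho> (x, i) =
    of_bool (real_vec x \<bullet> \<alpha> < \<rho>) - of_bool (real_vec x \<bullet> \<alpha> + \<alpha> $ i < \<rho>)"
  using assms by (auto simp: stepped_plane_def real_vec_add_axis)

text \<open>The bound on \<open>a\<close> keeps the new vector nonnegative, so both planes are
  differences of indicators. Types other than \<open>j\<close> have one-letter images; only type
  \<open>j\<close> requires telescoping.\<close>

lemma dual_map_stepped_plane:
  assumes "\<And>k. \<alpha> $ k \<ge> 0" "i \<noteq> j" "of_nat a * \<alpha> $ j \<le> \<alpha> $ i"
  shows "dual_map (brun_subst_inv a i j) (stepped_plane \<alpha> \<rho>) = stepped_plane (brun_step \<alpha> i j a) \<rho>"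
proof
  fix f :: "(int ^ 'a) \<times> 'a"
  obtain x c where f: "f = (x, c)" by (cases f)
  let ?M = "incidence_matrix (brun_subst_inv a i j)"
  let ?\<beta> = "brun_step \<alpha> i j a"
  define t where "t = real_vec x \<bullet> ?\<beta>"
  have t: "real_vec (?M *v x) \<bullet> \<alpha> = t"
    unfolding t_def by (rule incidence_matrix_brun_inner[OF assms(2)])
  have nonneg: "?\<beta> $ c \<ge> 0"
    using assms by (auto simp: brun_step_def)
  have plane: "stepped_plane \<alpha> \<rho> (?M *v x + m *s axis j 1, k) =
      of_bool (t + m * \<alpha> $ j < \<rho>) - of_bool (t + m * \<alpha> $ j + \<alpha> $ k < \<rho>)" for k and m :: int
    by (simp add: stepped_plane_apply[OF assms(1)] real_vec_add_scaled_axis t)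
  have rhs: "stepped_plane ?\<beta> \<rho> f = of_bool (t < \<rho>) - of_bool (t + ?\<beta> $ c < \<rho>)"
    by (simp add: f stepped_plane_apply[of ?\<beta> c, OF nonneg] t_def)
  consider "c = i" | "c = j" | "c \<noteq> i" "c \<noteq> j" by blast
  then have "dual_map (brun_subst_inv a i j) (stepped_plane \<alpha> \<rho>) (x, c) =
    of_bool (t < \<rho>) - of_bool (t + ?\<beta> $ c < \<rho>)"
  proof cases
    case 1
    then show ?thesis
      using plane[of 0 j] assms(2)
      by (simp add: dual_map_def brun_subst_inv_generators occurrences_single
          abelianization_simps brun_step_def del: append_Cons append_Nil)
  next
    case 3
    then show ?thesis
      using plane[of 0 c] assms(2)
      by (simp add: dual_map_def brun_subst_inv_generators occurrences_single
          abelianization_simps brun_step_def del: append_Cons append_Nil)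
  next
    case 2
    define H :: "nat \<Rightarrow> int" where "H m = of_bool (t - real m * \<alpha> $ j < \<rho>)" for m
    have inj: "inj_on (\<lambda>m. (replicate m (Neg j), j, replicate (a - Suc m) (Neg j) @ [Pos i])) {..<a}"
      by (auto simp: inj_on_def dest: arg_cong[where f = length])
    have "stepped_plane \<alpha> \<rho> (?M *v x + abelianization (replicate m (Neg j)) - axis j 1, j) =
        H (Suc m) - H m" for m
    proof -
      \<comment> \<open>The prefix contributes \<open>m\<close> steps back along \<open>e_j\<close>,
        and the shift built into the dual map for inverse letters one more, whence
        \<open>Suc m\<close>.\<close>
      have "?M *v x + abelianization (replicate m (Neg j)) - axis j 1 =
          ?M *v x + (- int (Suc m)) *s axis j 1"
        by (simp add: abelianization_simps vec_eq_iff axis_def algebra_simps)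
      then show ?thesis
        by (simp only: plane) (simp add: H_def algebra_simps)
    qed
    then have "(\<Sum>(p, k, s) \<in> {(p, k, s). replicate a (Neg j) @ [Pos i] = p @ [Neg k] @ s}.
        stepped_plane \<alpha> \<rho> (?M *v x + abelianization p - axis k 1, k)) = (\<Sum>m<a. H (Suc m) - H m)"
      unfolding occurrences_Neg by (subst sum.reindex[OF inj]) simp
    also have "\<dots> = H a - H 0"
      by (rule sum_lessThan_telescope)
    finally have "(\<Sum>(p, k, s) \<in> {(p, k, s). replicate a (Neg j) @ [Pos i] = p @ [Neg k] @ s}.
        stepped_plane \<alpha> \<rho> (?M *v x + abelianization p - axis k 1, k)) = H a - H 0" .
    moreover have "(\<Sum>(p, k, s) \<in> {(p, k, s). replicate a (Neg j) @ [Pos i] = p @ [Pos k] @ s}.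
        stepped_plane \<alpha> \<rho> (?M *v x + abelianization p, k)) =
        H a - of_bool (t - real a * \<alpha> $ j + \<alpha> $ i < \<rho>)"
      unfolding occurrences_Pos using plane[of "- int a" i]
      by (simp add: abelianization_simps H_def)
    \<comment> \<open>The term \<open>H a\<close> cancels between the positive and the negative
      sum.\<close>
    ultimately have "dual_map (brun_subst_inv a i j) (stepped_plane \<alpha> \<rho>) (x, c) =
        H 0 - of_bool (t - real a * \<alpha> $ j + \<alpha> $ i < \<rho>)"
      unfolding dual_map_def 2 prod.case brun_subst_inv_generators(2)[OF assms(2)]
      by linarith
    then show ?thesis
      using 2 assms(2) by (simp add: H_def brun_step_def algebra_simps)
  qed
  then show "dual_map (brun_subst_inv a i j) (stepped_plane \<alpha> \<rho>) f = stepped_plane ?\<beta> \<rho> f"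
    using rhs f by simp
qed

theorem theorem5p6:
  fixes \<alpha> :: "real ^ 'n::{finite,linorder}" and \<rho> :: real
  assumes "CARD('n) \<ge> 3"
    and "\<forall>i. \<alpha> $ i \<ge> 0" and "\<alpha> \<noteq> 0"
  shows "run_map (stepped_plane \<alpha> \<rho>) = stepped_plane (brun_map \<alpha>) \<rho>"
proof -
  have nonneg: "\<And>k. \<alpha> $ k \<ge> 0" using assms(2) by blast
  note pairs = is_run_pair_stepped_plane[OF nonneg]
  note pos_iff = brun_pair_pos_iff[OF nonneg assms(3)]
  show ?thesis
  proof (cases "\<alpha> \<in> {l *\<^sub>R axis i 1 | l i. l > 0}")
    case True
    then have "brun_map \<alpha> = \<alpha>"
      by (simp only: brun_map_def brun_matrix_def if_True matrix_inv_mat_1_vector_mult)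
    \<comment> \<open>On an axis no Brun pair has a positive second entry, so both maps fix their
      arguments.\<close>
    moreover have "\<not> is_run_pair (stepped_plane \<alpha> \<rho>) i j" for i j
      using True pairs pos_iff by blast
    ultimately show ?thesis
      by (simp add: run_map_def)
  next
    case False
    \<comment> \<open>Equal predicates make both maps select the same lexicographically smallest
      pair.\<close>
    then have same: "is_run_pair (stepped_plane \<alpha> \<rho>) = is_brun_pair \<alpha>"
      using pairs pos_iff by blast
    obtain k l :: 'n where "k \<noteq> l"
      using assms(1) card_le_Suc0_iff_eq[of "UNIV :: 'n set"] by auto
    then have ex: "\<exists>i j. is_brun_pair \<alpha> i j" by (rule ex_brun_pair)
    obtain i j where ij: "lex_least (is_brun_pair \<alpha>) = (i, j)" by fastforce
    have "is_lex_least (is_brun_pair \<alpha>) (i, j)"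
      unfolding ij[symmetric] lex_least_def by (rule theI'[OF ex1_lex_least[OF ex]])
    then have pair: "is_brun_pair \<alpha> i j" by (simp add: is_lex_least_def)
    then have j: "\<alpha> $ j > 0" and le: "\<alpha> $ j \<le> \<alpha> $ i" and "i \<noteq> j"
      using False pos_iff by (auto simp: is_brun_pair_iff)
    define a where "a = nat \<lfloor>\<alpha> $ i / \<alpha> $ j\<rfloor>"
    have a: "int a = \<lfloor>\<alpha> $ i / \<alpha> $ j\<rfloor>"
      using nonneg by (simp add: a_def)
    have "real a \<le> \<alpha> $ i / \<alpha> $ j"
      using a by linarith
    then have "real a * \<alpha> $ j \<le> \<alpha> $ i"
      using j by (simp add: field_simps)
    moreover have "run_map (stepped_plane \<alpha> \<rho>) = dual_map (brun_subst_inv a i j) (stepped_plane \<alpha> \<rho>)"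
      using ex by (simp add: run_map_def same ij shortest_run_length[OF j le] a_def)
    moreover have "brun_map \<alpha> = brun_step \<alpha> i j a"
      using \<open>i \<noteq> j\<close> unfolding brun_map_def brun_matrix_def if_not_P[OF False]
      by (simp add: ij matrix_inv_brun_elementary a)
    ultimately show ?thesis
      using dual_map_stepped_plane[OF nonneg \<open>i \<noteq> j\<close>] by simp
  qed
qed

end
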